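(* Let $x_0=1$ and let $w$ be the associated word. For every integer $m\ge1$, $$P(w,m)\ \ge\ \Bigl\lfloor\tfrac{41(m-1)}{24}\Bigr\rfloor+1.$$
   Context: With $x_0=1$, the orbit is defined by $x_{n+1}=\lceil 3x_n/2\rceil$ for $n\ge0$, and the word $w=(w_n)_{n\ge0}$ by $w_n=x_n\bmod 2\in\{0,1\}$; equivalently $w_n=2x_{n+1}-3x_n$. The complexity $P(w,m)$ is the number of distinct vectors $(w_j,w_{j+1},\dots,w_{j+m-1})$ as $j$ ranges over all non-negative integers. *)

theory Defs
  imports Complex_Main
begin

primrec orbit :: "int \<Rightarrow> nat \<Rightarrow> int" where
  "orbit a 0 = a"
| "orbit a (Suc n) = \<lceil>3 * real_of_int (orbit a n) / 2\<rceil>"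

definition parity_word :: "int \<Rightarrow> nat \<Rightarrow> int" where
  "parity_word a n = orbit a n mod 2"

definition factor :: "(nat \<Rightarrow> 'a) \<Rightarrow> nat \<Rightarrow> nat \<Rightarrow> 'a list" where
  "factor w m j = map (\<lambda>i. w (j + i)) [0..<m]"

text \<open>
  The cardinality is only meaningful for words over a finite alphabet;
  \<open>finite_factors_parity_word\<close> below covers the words considered here.
\<close>
definition complexity :: "(nat \<Rightarrow> 'a) \<Rightarrow> nat \<Rightarrow> nat" where
  "complexity w m = card (range (factor w m))"

lemma parity_word_in: "parity_word a n \<in> {0, 1}"
  by (auto simp: parity_word_def)

lemma parity_word_eq: "parity_word a n = 2 * orbit a (Suc n) - 3 * orbit a n"
proof (cases "even (orbit a n)")
  case True
  then obtain k where k: "orbit a n = 2 * k" by (elim evenE)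
  have "\<lceil>3 * real_of_int (2 * k) / 2\<rceil> = 3 * k"
    by (simp add: ceiling_eq_iff)
  with k show ?thesis by (simp add: parity_word_def)
next
  case False
  then obtain k where k: "orbit a n = 2 * k + 1" by (elim oddE)
  have "\<lceil>3 * real_of_int (2 * k + 1) / 2\<rceil> = 3 * k + 2"
    by (simp add: ceiling_eq_iff field_simps)
  with k show ?thesis by (simp add: parity_word_def)
qed

lemma finite_factors_parity_word: "finite (range (factor (parity_word a) m))"
proof (rule finite_subset)
  show "range (factor (parity_word a) m) \<subseteq> {xs. set xs \<subseteq> {0, 1} \<and> length xs = m}"
    using parity_word_in[of a] by (fastforce simp: factor_def)
  show "finite {xs. set xs \<subseteq> {0, 1::int} \<and> length xs = m}"
    by (rule finite_lists_length_eq) simp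
qed

end

theory Submission
  imports Defs
begin

text \<open>
  Two factors of length \<open>m\<close> coincide only if the orbit points at which they start are congruent
  modulo \<open>2 ^ m\<close>. The orbit of \<open>1\<close> increases strictly and satisfies \<open>x\<^sub>n + 1 \<le> 2 * (3 / 2) ^ n\<close>, so
  every \<open>x\<^sub>n\<close> with \<open>(3 / 2) ^ n \<le> 2 ^ (m - 1)\<close> lies below \<open>2 ^ m\<close>, and these points start distinct
  factors. By \<open>3 ^ 41 \<le> 2 ^ 65\<close>, all \<open>n \<le> 41 * (m - 1) / 24\<close> qualify.
\<close>

lemma orbit_Suc_double: "2 * orbit a (Suc n) = 3 * orbit a n + parity_word a n"
  using parity_word_eq[of a n] by linarith

lemma factor_Suc: "factor w (Suc m) j = w j # factor w m (Suc j)"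
  by (simp add: factor_def upt_conv_Cons map_Suc_upt[symmetric] del: upt_Suc)

text \<open>Equal first letters cancel in
  \<open>2 * orbit a (Suc n) = 3 * orbit a n + parity_word a n\<close>, so stepping back one index
  gains a factor 2; the 3 is harmless, being coprime to 2.\<close>

lemma factor_eq_imp_dvd:
  assumes "factor (parity_word a) m j = factor (parity_word a) m k"
  shows "2 ^ m dvd orbit a j - orbit a k"
  using assms
proof (induction m arbitrary: j k)
  case 0
  then show ?case by simp
next
  case (Suc m)
  then have w: "parity_word a j = parity_word a k"
    and "2 ^ m dvd orbit a (Suc j) - orbit a (Suc k)"
    by (auto simp: factor_Suc simp del: orbit.simps)
  then have "2 * 2 ^ m dvd 2 * (orbit a (Suc j) - orbit a (Suc k))"
    by (intro mult_dvd_mono dvd_refl)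
  also have "2 * (orbit a (Suc j) - orbit a (Suc k)) = 3 * (orbit a j - orbit a k)"
    using orbit_Suc_double[of a j] orbit_Suc_double[of a k] w
    by (simp add: algebra_simps del: orbit.simps)
  finally have "2 ^ Suc m dvd 3 * (orbit a j - orbit a k)"
    by simp
  moreover have "coprime (2 ^ Suc m) (3::int)"
    by (simp only: coprime_power_left_iff) simp
  ultimately show ?case
    using coprime_dvd_mult_right_iff by blast
qed

lemma orbit_pos:
  assumes "a > 0"
  shows "orbit a n > 0"
  by (induction n) (use assms in auto)

lemma strict_mono_orbit:
  assumes "a > 0"
  shows "strict_mono (orbit a)"
  unfolding strict_mono_Suc_iff
proof
  fix n
  show "orbit a n < orbit a (Suc n)"
    using orbit_Suc_double[of a n] orbit_pos[OF assms, of n] parity_word_in[of a n] by auto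
qed

text \<open>The shift by 1 turns the larger branch, x to (3 * x + 1) / 2, into multiplication by 3 /
  2.\<close>

lemma orbit_upper_bound: "real_of_int (orbit a n) + 1 \<le> (real_of_int a + 1) * (3 / 2) ^ n"
proof (induction n)
  case 0
  then show ?case by simp
next
  case (Suc n)
  have "2 * orbit a (Suc n) \<le> 3 * orbit a n + 1"
    using orbit_Suc_double[of a n] parity_word_in[of a n] by auto
  then have "2 * real_of_int (orbit a (Suc n)) \<le> 3 * real_of_int (orbit a n) + 1"
    by linarith
  with Suc show ?case
    by (simp del: orbit.simps)
qed

lemma complexity_ge_orbit:
  assumes "a > 0" and "orbit a N < 2 ^ m"
  shows "complexity (parity_word a) m \<ge> N + 1"
proof -
  have range: "orbit a n \<in> {0..<2 ^ m}" if "n \<le> N" for n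
    using orbit_pos[OF assms(1), of n] assms(2)
      strict_mono_less_eq[OF strict_mono_orbit[OF assms(1)], of n N] that by simp
  have "inj_on (factor (parity_word a) m) {..N}"
  proof (rule inj_onI)
    fix j k
    assume "j \<in> {..N}" "k \<in> {..N}" and "factor (parity_word a) m j = factor (parity_word a) m k"
    then have "orbit a j mod 2 ^ m = orbit a k mod 2 ^ m"
      by (simp add: factor_eq_imp_dvd mod_eq_dvd_iff)
    \<comment> \<open>Congruent numbers in \<open>{0..<2 ^ m}\<close> are equal.\<close>
    with range \<open>j \<in> {..N}\<close> \<open>k \<in> {..N}\<close> have "orbit a j = orbit a k"
      by simp
    then show "j = k"
      using strict_mono_eq[OF strict_mono_orbit[OF assms(1)]] by blast
  qed
  then have "N + 1 = card (factor (parity_word a) m ` {..N})"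
    by (simp add: card_image)
  also have "\<dots> \<le> complexity (parity_word a) m"
    unfolding complexity_def by (intro card_mono finite_factors_parity_word) auto
  finally show ?thesis .
qed

lemma three_halves_power_le:
  assumes "24 * N \<le> 41 * k"
  shows "(3 / 2 :: real) ^ N \<le> 2 ^ k"
proof (rule power_le_imp_le_base)
  \<comment> \<open>The 41st power lets the hypothesis compare integer exponents of 2.\<close>
  have "((3 / 2 :: real) ^ N) ^ Suc 40 = ((3 / 2) ^ 41) ^ N"
    by (simp flip: power_mult add: mult.commute)
  \<comment> \<open>\<open>3 ^ 41 \<le> 2 ^ 65\<close>, divided by \<open>2 ^ 41\<close>.\<close>
  also have "\<dots> \<le> (2 ^ 24) ^ N"
    by (intro power_mono) (simp_all add: power_divide)
  also have "\<dots> = (2 :: real) ^ (24 * N)"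
    by (simp only: power_mult)
  also have "\<dots> \<le> 2 ^ (41 * k)"
    using assms by (intro power_increasing) simp_all
  also have "\<dots> = (2 ^ k) ^ Suc 40"
    by (simp flip: power_mult add: mult.commute)
  finally show "((3 / 2 :: real) ^ N) ^ Suc 40 \<le> (2 ^ k) ^ Suc 40" .
qed simp

theorem corollary4p4:
  fixes m :: nat
  assumes "m \<ge> 1"
  shows "int (complexity (parity_word 1) m) \<ge> \<lfloor>41 * (real m - 1) / 24\<rfloor> + 1"
proof -
  obtain k where m: "m = Suc k"
    using assms by (cases m) auto
  define N where "N = 41 * k div 24"
  have "\<lfloor>41 * (real m - 1) / 24\<rfloor> = \<lfloor>real (41 * k) / real 24\<rfloor>"
    by (simp add: m)
  then have floor_eq: "\<lfloor>41 * (real m - 1) / 24\<rfloor> = int N"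
    by (simp only: floor_divide_of_nat_eq N_def)
  have "real_of_int (orbit 1 N) + 1 \<le> 2 * (3 / 2) ^ N"
    using orbit_upper_bound[of 1 N] by simp
  \<comment> \<open>The factor 2 is \<open>a + 1\<close> for \<open>a = 1\<close>; it uses up one of
    the \<open>m = Suc k\<close> powers of 2, hence m - 1 in the bound.\<close>
  also have "\<dots> \<le> 2 ^ m"
    using three_halves_power_le[of N k] by (simp add: N_def m)
  finally have "real_of_int (orbit 1 N) < 2 ^ m"
    by linarith
  then have "orbit 1 N < 2 ^ m"
    by simp
  then have "complexity (parity_word 1) m \<ge> N + 1"
    by (intro complexity_ge_orbit) simp_all
  then show ?thesis
    using floor_eq by simp
qed

end
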